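(* Let $s\ge 1$ be an integer, let $h$ be a fixed positive integer, and let $f,g$ be arithmetical functions having absolutely convergent Cohen-Ramanujan expansions $$f(n)=\sum_{r\ge1}\widehat f(r)\,c_r^{(s)}(n),\qquad g(n)=\sum_{k\ge1}\widehat g(k)\,c_k^{(s)}(n).$$ Suppose that $$\sum_{r,k\ge1}|\widehat f(r)|\,|\widehat g(k)|\,(r^sk^s)^{1/2}\,\tau_s(r^s)\,\tau_s(k^s)<\infty .$$ Then, as $N\to\infty$, $$\sum_{n\le N} f(n)g(n+h)\sim N\sum_{r\ge1}\widehat f(r)\,\widehat g(r)\,c_r^{(s)}(h).$$
   Context: For a positive integer $s$ and integers $m,n$ not both zero, the generalized gcd $(m,n)_s$ is the largest $l^s$ ($l\in\mathbb N$) dividing both $m$ and $n$. The Cohen-Ramanujan sum is $c_r^{(s)}(n)=\sum_{1\le a\le r^s,\ (a,r^s)_s=1} e^{2\pi i n a/r^s}$. For $s,n\in\mathbb N$, $\tau_s(n)$ is the number of $s$-th powers $l^s$ ($l\in\mathbb N$) dividing $n$. An expansion $f(n)=\sum_r \widehat f(r)c_r^{(s)}(n)$ is absolutely convergent if $\sum_r|\widehat f(r)c_r^{(s)}(n)|<\infty$ for every $n$.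
   Formalization: Write C for the series on the right. The relation ~ is asserted only when C is nonzero, since it fails for C = 0 (s = 1, f = 1, g(n) = (-1)^n); in all cases the sum is shown to equal NC + o(N), and convergence of the series for C is proved. *)

theory Defs
  imports "HOL-Analysis.Analysis" "HOL-Library.Landau_Symbols"
begin

definition gen_gcd :: "nat \<Rightarrow> int \<Rightarrow> int \<Rightarrow> nat" where
  "gen_gcd s m n = Max {l ^ s | l. 0 < l \<and> int (l ^ s) dvd m \<and> int (l ^ s) dvd n}"

definition cohen_ramanujan_sum :: "nat \<Rightarrow> nat \<Rightarrow> nat \<Rightarrow> complex" where
  "cohen_ramanujan_sum s r n =
     (\<Sum>a | a \<in> {1..r ^ s} \<and> gen_gcd s (int a) (int (r ^ s)) = 1.
        exp (2 * complex_of_real pi * \<i> * of_nat n * of_nat a / of_nat (r ^ s)))"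

definition tau_s :: "nat \<Rightarrow> nat \<Rightarrow> nat" where
  "tau_s s n = card {l ^ s | l. 0 < l \<and> l ^ s dvd n}"

text \<open>Arithmetical functions have the positive integers as their domain, so the values at
  \<open>0\<close> of \<open>f\<close> and of the coefficient function \<open>fh\<close> are irrelevant.\<close>

definition abs_conv_cr_expansion ::
  "nat \<Rightarrow> (nat \<Rightarrow> complex) \<Rightarrow> (nat \<Rightarrow> complex) \<Rightarrow> bool" where
  "abs_conv_cr_expansion s f fh \<longleftrightarrow>
     (\<forall>n\<ge>1. (\<lambda>r. norm (fh r * cohen_ramanujan_sum s r n)) summable_on {1..} \<and>
            ((\<lambda>r. fh r * cohen_ramanujan_sum s r n) has_sum f n) {1..})"

end

theory Submission
  imports Defs "HOL-Computational_Algebra.Primes"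
begin

text \<open>
  Expanding \<open>f(n) g(n + h)\<close> gives a double series over \<open>(r, k)\<close> whose coefficients are the means
  \<open>1/N \<Sum> c_r(n) c_k(n + h)\<close> over \<open>n \<le> N\<close>. As \<open>N\<close> grows such a mean converges to \<open>c_r(h)\<close> if
  \<open>r = k\<close> and to \<open>0\<close> otherwise, because a fraction \<open>a/r^s\<close> with \<open>(a, r^s)_s = 1\<close> determines \<open>r\<close>.
  The bound \<open>|c_r(n)| \<le> \<Sum> d^s\<close> over \<open>d dvd r\<close>, \<open>d^s dvd n\<close> together with Cauchy-Schwarz shows that
  the mean square of \<open>c_r\<close> over \<open>n \<le> N\<close> is at most \<open>r^s \<tau>_s(r^s)^2\<close>, uniformly in \<open>N\<close>.
  Hence the double series is dominated by the one assumed to converge, and the limit may be taken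
  termwise.
\<close>

section \<open>Roots of unity: complete sums and means of powers\<close>

definition root_of_unity :: "nat \<Rightarrow> nat \<Rightarrow> complex" where
  "root_of_unity q a = exp (2 * complex_of_real pi * \<i> * of_nat a / of_nat q)"

lemma root_of_unity_power: "root_of_unity q a ^ n = root_of_unity q (n * a)"
  by (simp add: root_of_unity_def mult_ac flip: exp_of_nat_mult)

lemma norm_root_of_unity [simp]: "norm (root_of_unity q a) = 1"
  by (simp add: root_of_unity_def norm_exp_eq_Re)

lemma root_of_unity_eq_1_iff: "q > 0 \<Longrightarrow> root_of_unity q a = 1 \<longleftrightarrow> q dvd a"
  unfolding root_of_unity_def using complex_root_unity_eq_1[of q a] by simp

lemma root_of_unity_cancel: "m > 0 \<Longrightarrow> root_of_unity (m * q) (m * a) = root_of_unity q a"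
  by (simp add: root_of_unity_def mult_ac)

lemma root_of_unity_mult:
  assumes "q > 0" "q' > 0"
  shows "root_of_unity q a * root_of_unity q' b = root_of_unity (q * q') (a * q' + b * q)"
  using assms by (simp add: root_of_unity_def field_simps flip: exp_add)

lemma sum_power_atLeast1:
  fixes z :: complex
  assumes "z \<noteq> 1"
  shows "(\<Sum>n=1..N. z ^ n) = z * (z ^ N - 1) / (z - 1)"
  using assms by (induction N) (simp_all add: field_simps)

lemma sum_root_of_unity:
  assumes "q > 0"
  shows "(\<Sum>b=1..q. root_of_unity q (n * b)) = (if q dvd n then of_nat q else 0)"
proof -
  have "(\<Sum>b=1..q. root_of_unity q (n * b)) = (\<Sum>b=1..q. root_of_unity q n ^ b)"
    by (simp add: root_of_unity_power mult.commute)
  also have "\<dots> = (if q dvd n then of_nat q else 0)"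
  proof (cases "q dvd n")
    case True
    then have "root_of_unity q n = 1"
      using assms by (simp add: root_of_unity_eq_1_iff)
    then show ?thesis using True by simp
  next
    case False
    then have "root_of_unity q n \<noteq> 1" "root_of_unity q n ^ q = 1"
      using assms by (simp_all add: root_of_unity_eq_1_iff root_of_unity_power)
    then show ?thesis
      using False by (subst sum_power_atLeast1) simp_all
  qed
  finally show ?thesis .
qed

text \<open>For \<open>z \<noteq> 1\<close> the geometric sums stay below
  \<open>2 / norm (z - 1)\<close> for every \<open>N\<close>, so dividing by \<open>N\<close> kills
  them. This is the orthogonality behind all the correlation limits.\<close>

lemma mean_power_tendsto:
  fixes z :: complex
  assumes "norm z = 1"
  shows "(\<lambda>N. (\<Sum>n=1..N. z ^ n) / of_nat N) \<longlonglongrightarrow> (if z = 1 then 1 else 0)"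
proof (cases "z = 1")
  case True
  \<comment> \<open>At \<open>N = 0\<close> the quotient is \<open>0 / 0 = 0\<close>, so the
    equality holds only for positive \<open>N\<close>.\<close>
  have "\<forall>\<^sub>F N in sequentially. (1::complex) = (\<Sum>n=1..N. z ^ n) / of_nat N"
    using eventually_gt_at_top[of 0] by eventually_elim (simp add: True)
  then show ?thesis
    using True by (auto intro: Lim_transform_eventually[OF tendsto_const])
next
  case False
  have "(\<lambda>N. (\<Sum>n=1..N. z ^ n) / of_nat N) \<longlonglongrightarrow> 0"
  proof (rule Lim_null_comparison)
    show "(\<lambda>N. (2 / norm (z - 1)) / real N) \<longlonglongrightarrow> 0"
      by (rule lim_const_over_n)
    have "norm (\<Sum>n=1..N. z ^ n) \<le> 2 / norm (z - 1)" for N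
    proof -
      have "norm (z ^ N - 1) \<le> 2"
        using norm_triangle_ineq4[of "z ^ N" 1] assms by (simp add: norm_power)
      then show ?thesis
        using False assms
        by (simp only: sum_power_atLeast1 not_False_eq_True) (simp add: norm_mult norm_divide divide_right_mono)
    qed
    then have "norm ((\<Sum>n=1..N. z ^ n) / of_nat N) \<le> 2 / norm (z - 1) / real N" for N
      unfolding norm_divide norm_of_nat by (rule divide_right_mono) simp
    then show "\<forall>\<^sub>F N in sequentially. norm ((\<Sum>n=1..N. z ^ n) / of_nat N) \<le> 2 / norm (z - 1) / real N"
      by simp
  qed
  then show ?thesis using False by simp
qed

section \<open>Products of distinct primes\<close>

lemma prod_prime_powers_dvd_iff:
  fixes T :: "nat set"
  assumes "finite T" "\<And>p. p \<in> T \<Longrightarrow> prime p"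
  shows "(\<Prod>T) ^ s dvd a \<longleftrightarrow> (\<forall>p\<in>T. p ^ s dvd a)"
  using assms
proof (induction T)
  case (insert p T)
  have "coprime (p ^ s) ((\<Prod>T) ^ s)"
    using insert by (auto intro!: prod_coprime_right primes_coprime)
  then have "p ^ s * (\<Prod>T) ^ s dvd a \<longleftrightarrow> p ^ s dvd a \<and> (\<Prod>T) ^ s dvd a"
    by (meson divides_mult dvd_mult_left dvd_mult_right)
  then show ?case using insert by (simp add: power_mult_distrib)
qed auto

text \<open>A set of primes can be recovered from its product; this later makes
  \<open>T \<mapsto> r div \<Prod>T\<close> injective.\<close>

lemma prime_factors_prod_primes:
  fixes T :: "nat set"
  assumes "finite T" "\<And>p. p \<in> T \<Longrightarrow> prime p"
  shows "prime_factors (\<Prod>T) = T"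
proof -
  have "0 \<notin> (\<lambda>p. p) ` T" using assms(2) by fastforce
  then have "prime_factors (\<Prod>T) = (\<Union>p\<in>T. prime_factors p)"
    using prime_factors_prod[of T "\<lambda>p. p"] assms(1) by simp
  also have "\<dots> = (\<Union>p\<in>T. {p})"
    using assms(2) by (intro SUP_cong refl) (simp add: prime_prime_factors)
  finally show ?thesis by simp
qed

section \<open>The index set of the Cohen-Ramanujan sum and Cohen's formula\<close>

text \<open>The index set of \<open>cohen_ramanujan_sum\<close> for positive \<open>s\<close> and
  \<open>r\<close>, freed of \<open>Max\<close>: since \<open>l ^ s dvd r ^ s\<close> means
  \<open>l dvd r\<close>, the gcd condition can be tested on the divisors of
  \<open>r\<close>.\<close>

definition cohen_units :: "nat \<Rightarrow> nat \<Rightarrow> nat set" where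
  "cohen_units s r = {a \<in> {1..r ^ s}. \<forall>l. l dvd r \<longrightarrow> l ^ s dvd a \<longrightarrow> l = 1}"

lemma finite_cohen_units [simp]: "finite (cohen_units s r)"
  by (simp add: cohen_units_def)

lemma gen_gcd_eq_1_iff:
  assumes "s \<ge> 1" "r \<ge> 1"
  shows "gen_gcd s (int a) (int (r ^ s)) = 1 \<longleftrightarrow> (\<forall>l. l dvd r \<longrightarrow> l ^ s dvd a \<longrightarrow> l = 1)"
proof -
  let ?X = "{l ^ s |l. 0 < l \<and> int (l ^ s) dvd int a \<and> int (l ^ s) dvd int (r ^ s)}"
  have "int (l ^ s) dvd int a \<longleftrightarrow> l ^ s dvd a" "0 < l \<and> int (l ^ s) dvd int (r ^ s) \<longleftrightarrow> l dvd r" for l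
    using assms by (auto simp del: of_nat_power intro: Nat.gr0I)
  then have X: "?X = (\<lambda>l. l ^ s) ` {l. l dvd r \<and> l ^ s dvd a}"
    by blast
  have "finite {l. l dvd r \<and> l ^ s dvd a}"
    by (rule finite_subset[of _ "{l. l dvd r}"]) (use assms in auto)
  then have "finite ?X" unfolding X by (rule finite_imageI)
  moreover have "1 \<in> ?X" unfolding X by (rule image_eqI[of _ _ 1]) simp_all
  ultimately have "Max ?X = 1 \<longleftrightarrow> (\<forall>x\<in>?X. x \<le> 1)"
    using Max_eq_iff[of ?X 1] by blast
  also have "\<dots> \<longleftrightarrow> (\<forall>l. l dvd r \<longrightarrow> l ^ s dvd a \<longrightarrow> l ^ s \<le> 1)"
    unfolding X by blast
  also have "\<dots> \<longleftrightarrow> (\<forall>l. l dvd r \<longrightarrow> l ^ s dvd a \<longrightarrow> l = 1)"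
  proof -
    have "l ^ s \<le> 1 \<longleftrightarrow> l = 1" if "l dvd r" for l
    proof -
      have "l \<ge> 1" using that assms by (auto intro: Nat.gr0I simp: Suc_le_eq)
      then show ?thesis using assms one_le_power[of l s]
        by (metis One_nat_def le_antisym nat_power_eq_Suc_0_iff not_one_le_zero order.refl)
    qed
    then show ?thesis by blast
  qed
  finally show ?thesis unfolding gen_gcd_def .
qed

text \<open>With \<open>n\<close> isolated as an exponent, sums over \<open>n\<close> become
  geometric sums.\<close>

lemma cohen_ramanujan_sum_eq_powers:
  assumes "s \<ge> 1" "r \<ge> 1"
  shows "cohen_ramanujan_sum s r n = (\<Sum>a\<in>cohen_units s r. root_of_unity (r ^ s) a ^ n)"
proof -
  have "{a. a \<in> {1..r ^ s} \<and> gen_gcd s (int a) (int (r ^ s)) = 1} = cohen_units s r"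
    unfolding cohen_units_def gen_gcd_eq_1_iff[OF assms] by simp
  then show ?thesis
    unfolding cohen_ramanujan_sum_def
    by (intro sum.cong) (simp_all add: root_of_unity_power, simp add: root_of_unity_def mult_ac)
qed

text \<open>Any forbidden \<open>l \<noteq> 1\<close> has a prime factor that is forbidden too. The
  condition is thus about finitely many primes, ready for inclusion-exclusion.\<close>

lemma cohen_units_iff_prime:
  assumes "r \<ge> 1"
  shows "a \<in> cohen_units s r \<longleftrightarrow> a \<in> {1..r ^ s} \<and> (\<forall>p\<in>prime_factors r. \<not> p ^ s dvd a)"
proof -
  have "(\<forall>l. l dvd r \<longrightarrow> l ^ s dvd a \<longrightarrow> l = 1) \<longleftrightarrow> (\<forall>p\<in>prime_factors r. \<not> p ^ s dvd a)"
  proof (intro iffI ballI allI impI notI)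
    fix p assume "\<forall>l. l dvd r \<longrightarrow> l ^ s dvd a \<longrightarrow> l = 1" "p \<in> prime_factors r" "p ^ s dvd a"
    then show False by (auto simp: in_prime_factors_iff)
  next
    fix l assume *: "\<forall>p\<in>prime_factors r. \<not> p ^ s dvd a" "l dvd r" "l ^ s dvd a"
    show "l = 1"
    proof (rule ccontr)
      assume "l \<noteq> 1"
      then obtain p where p: "prime p" "p dvd l" using prime_factor_nat by blast
      then have "p \<in> prime_factors r" "p ^ s dvd a"
        using * assms by (auto simp: in_prime_factors_iff dvd_power_same intro: dvd_trans)
      then show False using * by blast
    qed
  qed
  then show ?thesis by (auto simp: cohen_units_def)
qed

text \<open>Writing \<open>a = D ^ s * b\<close> reduces the fraction \<open>a / (D * d) ^ s\<close>
  to \<open>b / d ^ s\<close>, and \<open>b\<close> runs over a complete residue system modulo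
  \<open>d ^ s\<close>.\<close>

lemma sum_root_of_unity_multiples:
  assumes "D \<ge> 1" "d \<ge> 1"
  shows "(\<Sum>a | a \<in> {1..(D * d) ^ s} \<and> D ^ s dvd a. root_of_unity ((D * d) ^ s) (n * a)) =
           (if d ^ s dvd n then of_nat (d ^ s) else 0)"
proof -
  have "(\<Sum>a | a \<in> {1..(D * d) ^ s} \<and> D ^ s dvd a. root_of_unity ((D * d) ^ s) (n * a)) =
        (\<Sum>b=1..d ^ s. root_of_unity (d ^ s) (n * b))"
  proof (rule sum.reindex_bij_witness[of _ "\<lambda>b. D ^ s * b" "\<lambda>a. a div D ^ s"])
    fix a assume a: "a \<in> {a. a \<in> {1..(D * d) ^ s} \<and> D ^ s dvd a}"
    then obtain b where b: "a = D ^ s * b" by auto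
    have D: "D ^ s > 0" using assms by simp
    show "D ^ s * (a div D ^ s) = a" using a by simp
    show "a div D ^ s \<in> {1..d ^ s}"
      using a D by (auto simp: b power_mult_distrib Suc_le_eq)
    show "root_of_unity (d ^ s) (n * (a div D ^ s)) = root_of_unity ((D * d) ^ s) (n * a)"
      using root_of_unity_cancel[OF D, of "d ^ s" "n * b"] D by (simp add: b power_mult_distrib mult_ac)
  qed (use assms in \<open>auto simp: power_mult_distrib Suc_le_eq\<close>)
  then show ?thesis
    using sum_root_of_unity[of "d ^ s" n] assms by simp
qed

text \<open>Inclusion-exclusion over the primes dividing \<open>r\<close>; this is Cohen's formula
  \<open>c_r(n) = \<Sum> \<mu>(r/d) d^s\<close> over \<open>d dvd r\<close>, \<open>d^s dvd n\<close> with the squarefree numbers \<open>r/d\<close> given by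
  their sets of prime factors.\<close>

lemma cohen_ramanujan_sum_inclusion_exclusion:
  assumes "s \<ge> 1" "r \<ge> 1"
  shows "cohen_ramanujan_sum s r n =
    (\<Sum>T\<in>Pow (prime_factors r). (-1) ^ card T *
       (if (r div \<Prod>T) ^ s dvd n then of_nat ((r div \<Prod>T) ^ s) else 0))"
proof -
  let ?P = "prime_factors r" and ?z = "\<lambda>a. root_of_unity (r ^ s) (n * a)"
  have ind: "of_bool (\<forall>p\<in>?P. \<not> p ^ s dvd a) =
      (\<Sum>T\<in>Pow ?P. (-1) ^ card T * of_bool ((\<Prod>T) ^ s dvd a) :: complex)" for a
  proof -
    have "of_bool (\<forall>p\<in>?P. \<not> p ^ s dvd a) = (\<Prod>p\<in>?P. 1 - of_bool (p ^ s dvd a) :: complex)"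
    proof (cases "\<forall>p\<in>?P. \<not> p ^ s dvd a")
      case True
      then have "(\<Prod>p\<in>?P. 1 - of_bool (p ^ s dvd a) :: complex) = 1"
        by (intro prod.neutral) auto
      with True show ?thesis by simp
    next
      case False
      then have "(\<Prod>p\<in>?P. 1 - of_bool (p ^ s dvd a) :: complex) = 0"
        by (intro prod_zero) auto
      with False show ?thesis by simp
    qed
    \<comment> \<open>Expanding the product of the factors \<open>1 - of_bool (p ^ s dvd a)\<close>
      gives one term with sign \<open>(-1) ^ card T\<close> for each set \<open>T\<close> of
      primes.\<close>
    also have "\<dots> = (\<Sum>T\<in>Pow ?P. (-1) ^ card T * (\<Prod>p\<in>T. of_bool (p ^ s dvd a)))"
      by (subst prod_diff_conv_sum) auto
    also have "\<dots> = (\<Sum>T\<in>Pow ?P. (-1) ^ card T * of_bool ((\<Prod>T) ^ s dvd a))"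
    proof (intro sum.cong refl arg_cong2[where f = "(*)"])
      fix T assume "T \<in> Pow ?P"
      then have T: "finite T" "\<And>p. p \<in> T \<Longrightarrow> prime p"
        by (auto intro: finite_subset simp: in_prime_factors_iff)
      then show "(\<Prod>p\<in>T. of_bool (p ^ s dvd a)) = (of_bool ((\<Prod>T) ^ s dvd a) :: complex)"
        by (simp add: prod_prime_powers_dvd_iff)
    qed
    finally show ?thesis .
  qed
  have "cohen_ramanujan_sum s r n = (\<Sum>a\<in>cohen_units s r. ?z a)"
    using assms by (simp add: cohen_ramanujan_sum_eq_powers root_of_unity_power)
  also have "\<dots> = (\<Sum>a=1..r ^ s. of_bool (\<forall>p\<in>?P. \<not> p ^ s dvd a) * ?z a)"
    using assms by (intro sum.mono_neutral_cong_left) (auto simp: cohen_units_iff_prime)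
  also have "\<dots> = (\<Sum>T\<in>Pow ?P. (-1) ^ card T * (\<Sum>a=1..r ^ s. of_bool ((\<Prod>T) ^ s dvd a) * ?z a))"
    unfolding ind sum_distrib_left sum_distrib_right
    by (subst sum.swap) (simp add: mult_ac)
  also have "\<dots> = (\<Sum>T\<in>Pow ?P. (-1) ^ card T *
       (if (r div \<Prod>T) ^ s dvd n then of_nat ((r div \<Prod>T) ^ s) else 0))"
  proof (intro sum.cong refl arg_cong2[where f = "(*)"])
    fix T assume "T \<in> Pow ?P"
    then have T: "finite T" "\<And>p. p \<in> T \<Longrightarrow> prime p" "\<And>p. p \<in> T \<Longrightarrow> p dvd r"
      by (auto intro: finite_subset simp: in_prime_factors_iff)
    \<comment> \<open>The instance with exponent \<open>1\<close> of the divisibility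
      criterion.\<close>
    then have "\<Prod>T dvd r"
      using prod_prime_powers_dvd_iff[of T 1 r] by simp
    then have r: "r = \<Prod>T * (r div \<Prod>T)" by simp
    have pos: "\<Prod>T \<ge> 1" "r div \<Prod>T \<ge> 1"
      using assms(2) r by (metis One_nat_def Suc_leI mult_0 mult_0_right not_gr_zero not_one_le_zero)+
    have "(\<Sum>a=1..r ^ s. of_bool ((\<Prod>T) ^ s dvd a) * ?z a) = (\<Sum>a | a \<in> {1..r ^ s} \<and> (\<Prod>T) ^ s dvd a. ?z a)"
      by (intro sum.mono_neutral_cong_right) auto
    also have "\<dots> = (if (r div \<Prod>T) ^ s dvd n then of_nat ((r div \<Prod>T) ^ s) else 0)"
      using sum_root_of_unity_multiples[OF pos, of s n] unfolding r[symmetric] .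
    finally show "(\<Sum>a=1..r ^ s. of_bool ((\<Prod>T) ^ s dvd a) * ?z a) =
       (if (r div \<Prod>T) ^ s dvd n then of_nat ((r div \<Prod>T) ^ s) else 0)" .
  qed
  finally show ?thesis .
qed

section \<open>Pointwise and mean-square bounds\<close>

text \<open>Drop the signs in Cohen's formula. Different sets \<open>T\<close> give different
  divisors \<open>r div \<Prod>T\<close>, so the sum over \<open>T\<close> is part of the sum over
  all divisors of \<open>r\<close>.\<close>

lemma norm_cohen_ramanujan_sum_le:
  assumes "s \<ge> 1" "r \<ge> 1"
  shows "norm (cohen_ramanujan_sum s r n) \<le> (\<Sum>d | d dvd r. if d ^ s dvd n then real (d ^ s) else 0)"
proof -
  let ?F = "\<lambda>d. if d ^ s dvd n then real (d ^ s) else 0"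
  have T: "finite T" "\<And>p. p \<in> T \<Longrightarrow> prime p" "\<Prod>T dvd r" if "T \<subseteq> prime_factors r" for T
  proof -
    show 1: "finite T" and 2: "\<And>p. p \<in> T \<Longrightarrow> prime p"
      using that by (auto intro: finite_subset simp: in_prime_factors_iff)
    show "\<Prod>T dvd r"
      using prod_prime_powers_dvd_iff[OF 1 2, of 1 r] that by (auto simp: in_prime_factors_iff)
  qed
  have inj: "inj_on (\<lambda>T. r div \<Prod>T) (Pow (prime_factors r))"
  proof (rule inj_onI)
    fix T U assume TU: "T \<in> Pow (prime_factors r)" "U \<in> Pow (prime_factors r)"
      and eq: "r div \<Prod>T = r div \<Prod>U"
    then have dvd: "\<Prod>T dvd r" "\<Prod>U dvd r" using T(3) by blast+
    then have "\<Prod>T * (r div \<Prod>T) = \<Prod>U * (r div \<Prod>T)"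
      using eq by (metis dvd_mult_div_cancel)
    moreover have "r div \<Prod>T \<noteq> 0"
      using dvd assms(2) by (simp add: dvd_div_eq_0_iff)
    ultimately have "\<Prod>T = \<Prod>U" by simp
    moreover have "prime_factors (\<Prod>T) = T" "prime_factors (\<Prod>U) = U"
      using TU T(1,2) prime_factors_prod_primes by (meson PowD)+
    ultimately show "T = U" by metis
  qed
  have "norm (cohen_ramanujan_sum s r n) \<le> (\<Sum>T\<in>Pow (prime_factors r). ?F (r div \<Prod>T))"
    unfolding cohen_ramanujan_sum_inclusion_exclusion[OF assms]
    by (rule sum_norm_le) (simp add: norm_mult norm_power)
  also have "\<dots> = (\<Sum>d\<in>(\<lambda>T. r div \<Prod>T) ` Pow (prime_factors r). ?F d)"
    by (subst sum.reindex[OF inj]) simp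
  also have "\<dots> \<le> (\<Sum>d | d dvd r. ?F d)"
  proof (rule sum_mono2)
    show "(\<lambda>T. r div \<Prod>T) ` Pow (prime_factors r) \<subseteq> {d. d dvd r}"
      using T(3) by (metis (no_types, lifting) PowD dvd_div_mult_self dvd_triv_left image_subsetI mem_Collect_eq)
  qed (use assms(2) in auto)
  finally show ?thesis .
qed

lemma tau_s_power:
  assumes "s \<ge> 1" "r \<ge> 1"
  shows "tau_s s (r ^ s) = card {d. d dvd r}"
proof -
  have "0 < l \<and> l ^ s dvd r ^ s \<longleftrightarrow> l dvd r" for l
    using assms by (auto intro: Nat.gr0I)
  then have "{l ^ s |l. 0 < l \<and> l ^ s dvd r ^ s} = (\<lambda>l. l ^ s) ` {d. d dvd r}"
    by blast
  moreover have "inj_on (\<lambda>l::nat. l ^ s) {d. d dvd r}"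
    using assms by (auto intro!: inj_onI simp: power_eq_iff_eq_base)
  ultimately show ?thesis
    by (simp add: tau_s_def card_image)
qed

lemma sum_multiples_indicator: "(\<Sum>n=1..N. if q dvd n then 1 else 0) = N div q" for q N :: nat
  by (induction N) (auto simp: div_Suc dvd_eq_mod_eq_0)

text \<open>Cauchy-Schwarz over the divisors costs one factor \<open>tau_s\<close>. Each divisor
  \<open>d\<close> then contributes at most
  \<open>d ^ (2 * s) * (N / d ^ s) \<le> N * r ^ s\<close>, and counting the divisors gives the
  second factor.\<close>

lemma mean_square_cohen_ramanujan_sum:
  assumes "s \<ge> 1" "r \<ge> 1"
  shows "(\<Sum>n=1..N. (norm (cohen_ramanujan_sum s r n))\<^sup>2) \<le> real N * (real (r ^ s) * (real (tau_s s (r ^ s)))\<^sup>2)"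
proof -
  let ?D = "{d. d dvd r}" and ?x = "\<lambda>d n. if d ^ s dvd n then real (d ^ s) else 0"
  have fin: "finite ?D" using assms by simp
  have "(norm (cohen_ramanujan_sum s r n))\<^sup>2 \<le> real (card ?D) * (\<Sum>d\<in>?D. (?x d n)\<^sup>2)" for n
  proof -
    have "(norm (cohen_ramanujan_sum s r n))\<^sup>2 \<le> (\<Sum>d\<in>?D. ?x d n)\<^sup>2"
      by (intro power_mono norm_cohen_ramanujan_sum_le assms norm_ge_zero)
    also have "\<dots> \<le> (\<Sum>d\<in>?D. (?x d n)\<^sup>2) * real (card ?D)"
      by (rule sum_squared_le_sum_of_squares)
    finally show ?thesis by (simp add: mult.commute)
  qed
  then have "(\<Sum>n=1..N. (norm (cohen_ramanujan_sum s r n))\<^sup>2) \<le>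
        (\<Sum>n=1..N. real (card ?D) * (\<Sum>d\<in>?D. (?x d n)\<^sup>2))"
    by (rule sum_mono)
  also have "\<dots> = real (card ?D) * (\<Sum>d\<in>?D. \<Sum>n=1..N. (?x d n)\<^sup>2)"
    unfolding sum_distrib_left[symmetric] by (subst sum.swap) simp
  also have "\<dots> \<le> real (card ?D) * (\<Sum>d\<in>?D. real N * real (r ^ s))"
  proof (intro mult_left_mono sum_mono)
    fix d assume d: "d \<in> ?D"
    then have d0: "d > 0" using assms by (auto intro: Nat.gr0I)
    have "(\<Sum>n=1..N. (?x d n)\<^sup>2) = (\<Sum>n=1..N. (real (d ^ s))\<^sup>2 * real (if d ^ s dvd n then 1 else 0))"
      by (intro sum.cong) auto
    also have "\<dots> = (real (d ^ s))\<^sup>2 * real (N div d ^ s)"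
      by (simp only: sum_multiples_indicator flip: sum_distrib_left of_nat_sum)
    \<comment> \<open>Rounding \<open>N div d ^ s\<close> up to the real quotient leaves no error
      term, which keeps the bound uniform in \<open>N\<close>, even for
      \<open>N < d ^ s\<close>.\<close>
    also have "\<dots> \<le> (real (d ^ s))\<^sup>2 * (real N / real (d ^ s))"
      by (intro mult_left_mono of_nat_div_le_of_nat) simp
    also have "\<dots> = real N * real (d ^ s)"
      using d0 by (simp add: power2_eq_square)
    also have "\<dots> \<le> real N * real (r ^ s)"
      using d assms by (intro mult_left_mono of_nat_mono power_mono dvd_imp_le) auto
    finally show "(\<Sum>n=1..N. (?x d n)\<^sup>2) \<le> real N * real (r ^ s)" .
  qed simp
  also have "\<dots> = real N * (real (r ^ s) * (real (tau_s s (r ^ s)))\<^sup>2)"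
    by (simp add: tau_s_power[OF assms] power2_eq_square mult_ac)
  finally show ?thesis .
qed

text \<open>Cauchy-Schwarz over \<open>n\<close> and the two mean-square bounds; the factor
  \<open>h + 1\<close> pays for the shift.\<close>

lemma norm_correlation_le:
  assumes "s \<ge> 1" "r \<ge> 1" "k \<ge> 1"
  shows "norm (\<Sum>n=1..N. cohen_ramanujan_sum s r n * cohen_ramanujan_sum s k (n + h)) \<le>
    real N * (real (h + 1) * (sqrt (real (r ^ s) * real (k ^ s)) * real (tau_s s (r ^ s)) * real (tau_s s (k ^ s))))"
    (is "norm ?S \<le> real N * (real (h + 1) * ?B)")
proof (cases "N = 0")
  case False
  let ?x = "\<lambda>n. norm (cohen_ramanujan_sum s r n)" and ?y = "\<lambda>n. norm (cohen_ramanujan_sum s k n)"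
  let ?R = "real (r ^ s) * (real (tau_s s (r ^ s)))\<^sup>2" and ?K = "real (k ^ s) * (real (tau_s s (k ^ s)))\<^sup>2"
  have "(\<Sum>n=1..N. (?y (n + h))\<^sup>2) = (\<Sum>n=1+h..N+h. (?y n)\<^sup>2)"
    by (simp only: sum.shift_bounds_cl_nat_ivl)
  also have "\<dots> \<le> (\<Sum>n=1..N+h. (?y n)\<^sup>2)"
    by (intro sum_mono2) auto
  also have "\<dots> \<le> real (N + h) * ?K"
    by (rule mean_square_cohen_ramanujan_sum) fact+
  \<comment> \<open>For \<open>N \<ge> 1\<close> we have
    \<open>N + h \<le> N * (h + 1)\<^sup>2\<close>; the square is there so that its root is
    \<open>h + 1\<close>.\<close>
  also have "\<dots> \<le> (real N * (real (h + 1))\<^sup>2) * ?K"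
  proof (intro mult_right_mono)
    have "N + h \<le> N * (h + 1)\<^sup>2"
      using False by (cases N) (auto simp: power2_eq_square)
    then show "real (N + h) \<le> real N * (real (h + 1))\<^sup>2"
      by (metis of_nat_le_iff of_nat_mult of_nat_power)
  qed auto
  finally have y: "(\<Sum>n=1..N. (?y (n + h))\<^sup>2) \<le> (real N * (real (h + 1))\<^sup>2) * ?K" .
  have x: "(\<Sum>n=1..N. (?x n)\<^sup>2) \<le> real N * ?R"
    by (rule mean_square_cohen_ramanujan_sum) fact+
  have "(\<Sum>n=1..N. ?x n * ?y (n + h))\<^sup>2 \<le> (\<Sum>n=1..N. (?x n)\<^sup>2) * (\<Sum>n=1..N. (?y (n + h))\<^sup>2)"
    by (rule Cauchy_Schwarz_ineq_sum)
  also have "\<dots> \<le> (real N * ?R) * ((real N * (real (h + 1))\<^sup>2) * ?K)"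
    by (intro mult_mono x y sum_nonneg) auto
  also have "\<dots> = (real N * (real (h + 1) * ?B))\<^sup>2"
    by (simp add: power_mult_distrib power2_eq_square mult_ac)
  finally have "(\<Sum>n=1..N. ?x n * ?y (n + h)) \<le> real N * (real (h + 1) * ?B)"
    by (rule power2_le_imp_le) simp
  moreover have "norm ?S \<le> (\<Sum>n=1..N. ?x n * ?y (n + h))"
    by (rule sum_norm_le) (simp add: norm_mult)
  ultimately show ?thesis by linarith
qed simp

section \<open>Limits of the correlations\<close>

text \<open>The divisibility says that \<open>a / r ^ s + b / k ^ s\<close> is an integer. After
  cancelling the gcd \<open>m\<close>, the coprime cofactors satisfy \<open>r' ^ s dvd a\<close> and
  \<open>k' ^ s dvd b\<close>, and membership in \<open>cohen_units\<close> forces both cofactors to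
  be \<open>1\<close>.\<close>

lemma cohen_units_reduced_unique:
  assumes "r \<ge> 1" "k \<ge> 1" "a \<in> cohen_units s r" "b \<in> cohen_units s k"
    and "r ^ s * k ^ s dvd a * k ^ s + b * r ^ s"
  shows "r = k"
proof -
  define m where "m = gcd r k"
  obtain r' k' where rk: "r = m * r'" "k = m * k'" "coprime r' k'"
    using gcd_coprime_exists[of r k] assms(1) unfolding m_def
    by (metis gcd_eq_0_iff mult.commute not_one_le_zero)
  have "m > 0" using assms(1) by (simp add: m_def)
  have "m ^ s * (m ^ s * (r' ^ s * k' ^ s)) dvd m ^ s * (a * k' ^ s + b * r' ^ s)"
    using assms(5) by (simp add: rk power_mult_distrib algebra_simps)
  then have "m ^ s * (r' ^ s * k' ^ s) dvd a * k' ^ s + b * r' ^ s"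
    using \<open>m > 0\<close> by (subst (asm) nat_mult_dvd_cancel1) simp_all
  then have dvd: "r' ^ s dvd a * k' ^ s + b * r' ^ s" "k' ^ s dvd a * k' ^ s + b * r' ^ s"
    by (metis dvd_mult_left dvd_mult_right mult.assoc mult.commute)+
  have "r' ^ s dvd a * k' ^ s" "k' ^ s dvd b * r' ^ s"
    using dvd by (metis dvd_add_left_iff dvd_triv_right, metis dvd_add_right_iff dvd_triv_right)
  then have "r' ^ s dvd a" "k' ^ s dvd b"
    using rk(3) by (auto simp: coprime_dvd_mult_left_iff coprime_commute)
  then have "r' = 1" "k' = 1"
    using assms(3,4) rk by (auto simp: cohen_units_def)
  then show ?thesis using rk by simp
qed

text \<open>Negation modulo \<open>r ^ s\<close> permutes the index set: \<open>l ^ s\<close>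
  divides \<open>r ^ s - b\<close> only if it divides \<open>b\<close>, for \<open>l dvd r\<close>.
  Uniqueness holds because two representatives differ by less than \<open>r ^ s\<close>.\<close>

lemma cohen_units_negation:
  assumes "s \<ge> 1" "r \<ge> 1" "b \<in> cohen_units s r"
  shows "\<exists>!a. a \<in> cohen_units s r \<and> r ^ s dvd a + b"
proof (rule ex_ex1I)
  show "\<exists>a. a \<in> cohen_units s r \<and> r ^ s dvd a + b"
  proof (cases "b = r ^ s")
    \<comment> \<open>Here \<open>r ^ s - b = 0\<close> lies outside the range of representatives,
      but \<open>b\<close> is its own negative.\<close>
    case True
    then show ?thesis using assms(3) by (intro exI[of _ b]) simp
  next
    case False
    then have b: "1 \<le> b" "b < r ^ s" using assms(3) by (auto simp: cohen_units_def)
    have "l = 1" if "l dvd r" "l ^ s dvd r ^ s - b" for l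
    proof -
      have "l ^ s dvd b"
        using that b by (metis dvd_diffD1 dvd_power_same less_imp_le)
      then show ?thesis using assms(3) that by (auto simp: cohen_units_def)
    qed
    then have "r ^ s - b \<in> cohen_units s r"
      using b by (auto simp: cohen_units_def)
    then show ?thesis using b by (intro exI[of _ "r ^ s - b"]) simp
  qed
next
  have *: "a = a'" if "a \<le> a'" "a \<in> cohen_units s r \<and> r ^ s dvd a + b"
    "a' \<in> cohen_units s r \<and> r ^ s dvd a' + b" for a a'
  proof -
    have "r ^ s dvd a' - a" using that
      by (metis add_diff_cancel_right dvd_diff_nat)
    moreover have "a' - a < r ^ s"
      using that by (auto simp: cohen_units_def)
    ultimately show ?thesis using that(1) by (metis diff_is_0_eq dvd_imp_le le_antisym not_le not_gr_zero)
  qed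
  fix a a' assume "a \<in> cohen_units s r \<and> r ^ s dvd a + b" "a' \<in> cohen_units s r \<and> r ^ s dvd a' + b"
  then show "a = a'" using *[of a a'] *[of a' a] by linarith
qed

text \<open>After expanding both sums, the mean over \<open>n\<close> retains exactly the pairs for
  which \<open>a / r ^ s + b / k ^ s\<close> is an integer. There are none if
  \<open>r \<noteq> k\<close>; if \<open>r = k\<close>, each \<open>b\<close> has one partner
  \<open>a\<close>, and the remaining factors \<open>?v b ^ h\<close> add up to
  \<open>c_r(h)\<close>.\<close>

lemma correlation_tendsto:
  assumes "s \<ge> 1" "r \<ge> 1" "k \<ge> 1"
  shows "(\<lambda>N. (\<Sum>n=1..N. cohen_ramanujan_sum s r n * cohen_ramanujan_sum s k (n + h)) / of_nat N)
      \<longlonglongrightarrow> (if r = k then cohen_ramanujan_sum s r h else 0)"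
proof -
  let ?w = "root_of_unity (r ^ s)" and ?v = "root_of_unity (k ^ s)"
  let ?U = "cohen_units s r" and ?V = "cohen_units s k"
  have "(\<Sum>n=1..N. cohen_ramanujan_sum s r n * cohen_ramanujan_sum s k (n + h)) / of_nat N =
     (\<Sum>b\<in>?V. \<Sum>a\<in>?U. ?v b ^ h * ((\<Sum>n=1..N. (?w a * ?v b) ^ n) / of_nat N))" for N
  proof -
    have "(\<Sum>n=1..N. cohen_ramanujan_sum s r n * cohen_ramanujan_sum s k (n + h)) =
        (\<Sum>n=1..N. \<Sum>b\<in>?V. \<Sum>a\<in>?U. ?v b ^ h * (?w a * ?v b) ^ n)"
      unfolding cohen_ramanujan_sum_eq_powers[OF assms(1,2)] cohen_ramanujan_sum_eq_powers[OF assms(1,3)]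
        sum_product
      by (subst sum.swap) (simp add: power_add power_mult_distrib mult_ac)
    also have "\<dots> = (\<Sum>b\<in>?V. \<Sum>n=1..N. \<Sum>a\<in>?U. ?v b ^ h * (?w a * ?v b) ^ n)"
      by (rule sum.swap)
    also have "\<dots> = (\<Sum>b\<in>?V. \<Sum>a\<in>?U. \<Sum>n=1..N. ?v b ^ h * (?w a * ?v b) ^ n)"
      by (intro sum.cong refl sum.swap)
    finally show ?thesis
      by (simp add: sum_divide_distrib sum_distrib_left)
  qed
  moreover have "(\<lambda>N. \<Sum>b\<in>?V. \<Sum>a\<in>?U. ?v b ^ h * ((\<Sum>n=1..N. (?w a * ?v b) ^ n) / of_nat N))
     \<longlonglongrightarrow> (\<Sum>b\<in>?V. \<Sum>a\<in>?U. ?v b ^ h * (if ?w a * ?v b = 1 then 1 else 0))"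
    by (intro tendsto_sum tendsto_mult_left mean_power_tendsto) (simp add: norm_mult)
  moreover have "(\<Sum>b\<in>?V. \<Sum>a\<in>?U. ?v b ^ h * (if ?w a * ?v b = 1 then 1 else 0)) =
      (if r = k then cohen_ramanujan_sum s r h else 0)"
  proof (cases "r = k")
    case True
    have "(\<Sum>a\<in>?U. ?v b ^ h * (if ?w a * ?v b = 1 then 1 else 0)) = ?v b ^ h" if b: "b \<in> ?V" for b
    proof -
      obtain c where c: "a \<in> ?U \<and> r ^ s dvd a + b \<longleftrightarrow> a = c" for a
        using cohen_units_negation[OF assms(1,2), of b] b True by metis
      \<comment> \<open>\<open>root_of_unity_mult\<close> produces the denominator
        \<open>r ^ s * r ^ s\<close>, of which one factor cancels.\<close>
      have "?w a * ?v b = 1 \<longleftrightarrow> r ^ s dvd a + b" for a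
        using assms(2) root_of_unity_cancel[of "r ^ s" "r ^ s" "a + b"]
        by (simp add: root_of_unity_mult root_of_unity_eq_1_iff algebra_simps flip: True)
      then have "(\<Sum>a\<in>?U. ?v b ^ h * (if ?w a * ?v b = 1 then 1 else 0)) =
          (\<Sum>a\<in>?U. if a = c then ?v b ^ h else 0)"
        using c by (intro sum.cong) auto
      moreover have "c \<in> ?U" using c by blast
      ultimately show ?thesis by simp
    qed
    then show ?thesis
      using True assms by (simp add: cohen_ramanujan_sum_eq_powers)
  next
    case False
    have "?w a * ?v b \<noteq> 1" if "a \<in> ?U" "b \<in> ?V" for a b
      using cohen_units_reduced_unique[OF assms(2,3) that] False assms
      by (auto simp: root_of_unity_mult root_of_unity_eq_1_iff)
    then show ?thesis using False by (auto intro!: sum.neutral)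
  qed
  ultimately show ?thesis by simp
qed

section \<open>Limits and products of unordered sums\<close>

text \<open>Tannery's theorem for unordered sums. By the Weierstrass M-test the finite partial sums
  converge uniformly in \<open>N\<close>, so the limits over \<open>N\<close> and over finite
  subsets may be exchanged; the majorant passes to \<open>G\<close>.\<close>

lemma dominated_has_sum_tendsto:
  fixes F :: "nat \<Rightarrow> 'a \<Rightarrow> 'b :: banach"
  assumes "\<And>N x. x \<in> X \<Longrightarrow> norm (F N x) \<le> M x"
    and "\<And>x. x \<in> X \<Longrightarrow> (\<lambda>N. F N x) \<longlonglongrightarrow> G x"
    and "\<And>N. (F N has_sum S N) X"
    and "M summable_on X"
  shows "G summable_on X" "S \<longlonglongrightarrow> infsum G X"
proof -
  have "norm (G x) \<le> M x" if "x \<in> X" for x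
    using assms(1)[OF that] tendsto_norm[OF assms(2)[OF that]]
    by (intro LIMSEQ_le_const2) auto
  then show G: "G summable_on X"
    by (intro abs_summable_summable[OF Infinite_Sum.abs_summable_on_comparison_test'[OF assms(4)]])
  show "S \<longlonglongrightarrow> infsum G X"
  proof (rule swap_uniform_limit')
    show "uniform_limit UNIV (\<lambda>Y N. \<Sum>x\<in>Y. F N x) S (finite_subsets_at_top X)"
      using assms(1,3,4) by (intro Weierstrass_m_test_general') auto
    show "(sum G \<longlongrightarrow> infsum G X) (finite_subsets_at_top X)"
      using G by (rule infsum_tendsto)
    show "\<forall>\<^sub>F Y in finite_subsets_at_top X. (\<lambda>N. \<Sum>x\<in>Y. F N x) \<longlonglongrightarrow> sum G Y"
      by (rule eventually_finite_subsets_at_top_weakI) (use assms(2) in \<open>auto intro!: tendsto_sum\<close>)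
  qed auto
qed

text \<open>The iterated sum is \<open>x * y\<close>, and absolute summability of the double family
  identifies it with the sum over the product set.\<close>

lemma has_sum_abs_product:
  fixes u :: "'a \<Rightarrow> complex" and v :: "'b \<Rightarrow> complex"
  assumes "(\<lambda>a. norm (u a)) summable_on A" "(\<lambda>b. norm (v b)) summable_on B" "(u has_sum x) A" "(v has_sum y) B"
  shows "((\<lambda>(a, b). u a * v b) has_sum (x * y)) (A \<times> B)"
proof (rule has_sum_SigmaI)
  show "((\<lambda>a. u a * y) has_sum x * y) A"
    by (rule has_sum_cmult_left[OF assms(3)])
  show "((\<lambda>b. case (a, b) of (a, b) \<Rightarrow> u a * v b) has_sum u a * y) B" for a
    using has_sum_cmult_right[OF assms(4), of "u a"] by simp
  have "(\<lambda>x. norm (case x of (a, b) \<Rightarrow> u a * v b)) summable_on A \<times> B"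
    using assms(1,2)
    by (auto simp: Infinite_Sum.abs_summable_on_Sigma_iff norm_mult infsum_cmult_right' abs_mult
         intro!: summable_on_cmult_right summable_on_cmult_left)
  then show "(\<lambda>(a, b). u a * v b) summable_on A \<times> B"
    by (rule abs_summable_summable)
qed

lemma has_sum_finite_sum:
  fixes F :: "'i \<Rightarrow> 'a \<Rightarrow> complex"
  assumes "finite I" "\<And>i. i \<in> I \<Longrightarrow> (F i has_sum S i) X"
  shows "((\<lambda>x. \<Sum>i\<in>I. F i x) has_sum (\<Sum>i\<in>I. S i)) X"
  using assms by (induction I rule: finite_induct) (auto intro!: has_sum_add)

section \<open>The mean of the shifted product\<close>

lemma shifted_correlation_limit:
  assumes "s \<ge> 1"
    and f: "abs_conv_cr_expansion s f fh"
    and g: "abs_conv_cr_expansion s g gh"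
    and dom: "(\<lambda>(r, k). norm (fh r) * norm (gh k) * sqrt (real (r ^ s) * real (k ^ s))
            * real (tau_s s (r ^ s)) * real (tau_s s (k ^ s))) summable_on ({1..} \<times> {1..})"
  shows "(\<lambda>r. fh r * gh r * cohen_ramanujan_sum s r h) summable_on {1..}" (is ?th1)
    and "(\<lambda>N. (\<Sum>n=1..N. f n * g (n + h)) / of_nat N) \<longlonglongrightarrow>
           (\<Sum>\<^sub>\<infinity>r\<in>{1..}. fh r * gh r * cohen_ramanujan_sum s r h)" (is ?th2)
proof -
  let ?c = "cohen_ramanujan_sum s" and ?X = "{1::nat..} \<times> {1::nat..}"
  \<comment> \<open>\<open>F N\<close> has the mean as its sum, \<open>G\<close> is its termwise
    limit, and \<open>B\<close> is the majorant up to the constant \<open>h + 1\<close>.\<close>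
  define F where "F = (\<lambda>N (r, k). fh r * gh k * ((\<Sum>n=1..N. ?c r n * ?c k (n + h)) / of_nat N))"
  define G where "G = (\<lambda>(r, k). fh r * gh k * (if r = k then ?c r h else 0))"
  define B where "B = (\<lambda>(r, k). norm (fh r) * norm (gh k) * sqrt (real (r ^ s) * real (k ^ s))
            * real (tau_s s (r ^ s)) * real (tau_s s (k ^ s)))"
  have 1: "norm (F N x) \<le> real (h + 1) * B x" if X: "x \<in> ?X" for N x
  proof -
    obtain r k where x: "x = (r, k)" "r \<ge> 1" "k \<ge> 1" using X by auto
    have "norm ((\<Sum>n=1..N. ?c r n * ?c k (n + h)) / of_nat N) \<le>
       real (h + 1) * (sqrt (real (r ^ s) * real (k ^ s)) * real (tau_s s (r ^ s)) * real (tau_s s (k ^ s)))"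
    proof (cases "N = 0")
      case False
      then show ?thesis
        using norm_correlation_le[OF assms(1) x(2,3), of h N]
        by (simp only: norm_divide norm_of_nat) (simp add: divide_le_eq mult.commute)
    qed simp
    then have "norm (fh r * gh k) * norm ((\<Sum>n=1..N. ?c r n * ?c k (n + h)) / of_nat N) \<le>
      norm (fh r * gh k) * (real (h + 1) * (sqrt (real (r ^ s) * real (k ^ s)) * real (tau_s s (r ^ s)) * real (tau_s s (k ^ s))))"
      by (rule mult_left_mono) simp
    then show ?thesis
      by (simp only: x F_def B_def prod.case norm_mult) (simp only: mult_ac)
  qed
  have 2: "(\<lambda>N. F N x) \<longlonglongrightarrow> G x" if X: "x \<in> ?X" for x
  proof -
    obtain r k where x: "x = (r, k)" "r \<ge> 1" "k \<ge> 1" using X by auto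
    show ?thesis
      unfolding F_def G_def x(1) prod.case
      by (intro tendsto_mult_left correlation_tendsto assms(1) x(2,3))
  qed
  have 3: "(F N has_sum ((\<Sum>n=1..N. f n * g (n + h)) / of_nat N)) ?X" for N
  proof -
    \<comment> \<open>Both expansions apply because \<open>n\<close> and \<open>n + h\<close> are
      positive. For fixed \<open>N\<close> only finitely many double series are then added.\<close>
    have "((\<lambda>(r, k). (fh r * ?c r n) * (gh k * ?c k (n + h))) has_sum (f n * g (n + h))) ?X"
      if "n \<in> {1..N}" for n
      using f g that by (intro has_sum_abs_product) (auto simp: abs_conv_cr_expansion_def)
    then have "((\<lambda>x. \<Sum>n=1..N. case x of (r, k) \<Rightarrow> (fh r * ?c r n) * (gh k * ?c k (n + h)))
        has_sum (\<Sum>n=1..N. f n * g (n + h))) ?X"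
      by (rule has_sum_finite_sum[OF finite_atLeastAtMost])
    from has_sum_cmult_left[OF this, of "1 / of_nat N"]
    have "((\<lambda>x. (\<Sum>n=1..N. case x of (r, k) \<Rightarrow> (fh r * ?c r n) * (gh k * ?c k (n + h))) / of_nat N)
        has_sum ((\<Sum>n=1..N. f n * g (n + h)) / of_nat N)) ?X"
      by simp
    also have "(\<lambda>x. (\<Sum>n=1..N. case x of (r, k) \<Rightarrow> (fh r * ?c r n) * (gh k * ?c k (n + h))) / of_nat N) = F N"
      by (auto simp: F_def sum_distrib_left fun_eq_iff mult_ac)
    finally show ?thesis .
  qed
  have 4: "(\<lambda>x. real (h + 1) * B x) summable_on ?X"
    using dom unfolding B_def by (rule summable_on_cmult_right)
  note lim = dominated_has_sum_tendsto[OF 1 2 3 4]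
  have "(G has_sum infsum G ?X) ?X"
    using lim(1) by simp
  \<comment> \<open>\<open>G\<close> vanishes off the diagonal, so the double sum collapses to a
    single one.\<close>
  also have "?this \<longleftrightarrow> (G has_sum infsum G ?X) ((\<lambda>r. (r, r)) ` {1..})"
    by (intro has_sum_cong_neutral) (auto simp: G_def)
  also have "\<dots> \<longleftrightarrow> ((G \<circ> (\<lambda>r. (r, r))) has_sum infsum G ?X) {1..}"
    by (intro has_sum_reindex) (auto intro: inj_onI)
  also have "G \<circ> (\<lambda>r. (r, r)) = (\<lambda>r. fh r * gh r * ?c r h)"
    by (auto simp: G_def)
  finally have sum: "((\<lambda>r. fh r * gh r * ?c r h) has_sum infsum G ?X) {1..}" .
  then show ?th1 by (auto simp: summable_on_def)
  show ?th2 using lim(2) infsumI[OF sum] by simp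
qed

text \<open>Equivalence to the zero function would force \<open>S\<close> to vanish eventually, so
  \<open>C = 0\<close> is covered by the \<open>o(N)\<close> form. Summability is stated separately
  since \<open>infsum\<close> defaults to \<open>0\<close> for families that are not
  summable.\<close>

theorem theorem1p2:
  fixes s h :: nat and f g fh gh :: "nat \<Rightarrow> complex"
  assumes "s \<ge> 1" and "h \<ge> 1"
    and "abs_conv_cr_expansion s f fh"
    and "abs_conv_cr_expansion s g gh"
    and "(\<lambda>(r, k). norm (fh r) * norm (gh k) * sqrt (real (r ^ s) * real (k ^ s))
            * real (tau_s s (r ^ s)) * real (tau_s s (k ^ s))) summable_on ({1..} \<times> {1..})"
  shows "(\<lambda>r. fh r * gh r * cohen_ramanujan_sum s r h) summable_on {1..} \<and>
    (let C = (\<Sum>\<^sub>\<infinity>r\<in>{1..}. fh r * gh r * cohen_ramanujan_sum s r h);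
         S = (\<lambda>N::nat. \<Sum>n=1..N. f n * g (n + h))
     in (C \<noteq> 0 \<longrightarrow> S \<sim>[at_top] (\<lambda>N. of_nat N * C)) \<and>
        (\<lambda>N. S N - of_nat N * C) \<in> o[at_top](\<lambda>N. of_nat N))"
proof -
  note lim = shifted_correlation_limit[OF assms(1,3-5), of h]
  define C where "C = (\<Sum>\<^sub>\<infinity>r\<in>{1..}. fh r * gh r * cohen_ramanujan_sum s r h)"
  define S where "S = (\<lambda>N::nat. \<Sum>n=1..N. f n * g (n + h))"
  have SC: "(\<lambda>N. S N / of_nat N) \<longlonglongrightarrow> C"
    using lim(2) by (simp add: S_def C_def)
  have nz: "\<forall>\<^sub>F N in sequentially. (of_nat N :: complex) \<noteq> 0"
    using eventually_gt_at_top[of 0] by eventually_elim simp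
  have "S \<sim>[at_top] (\<lambda>N. of_nat N * C)" if "C \<noteq> 0"
  proof (rule asymp_equivI')
    have "(\<lambda>N. S N / of_nat N / C) \<longlonglongrightarrow> C / C"
      using SC that by (intro tendsto_divide tendsto_const)
    then show "(\<lambda>N. S N / (of_nat N * C)) \<longlonglongrightarrow> 1"
      using that by simp
  qed
  moreover have "(\<lambda>N. S N - of_nat N * C) \<in> o[at_top](\<lambda>N. of_nat N :: complex)"
  proof (rule smalloI_tendsto[OF _ nz])
    have "(\<lambda>N. S N / of_nat N - C) \<longlonglongrightarrow> C - C"
      by (intro tendsto_diff SC tendsto_const)
    moreover have "\<forall>\<^sub>F N in sequentially. S N / of_nat N - C = (S N - of_nat N * C) / of_nat N"
      using nz by eventually_elim (simp add: field_simps)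
    ultimately show "(\<lambda>N. (S N - of_nat N * C) / of_nat N) \<longlonglongrightarrow> 0"
      by (auto intro: Lim_transform_eventually)
  qed
  ultimately show ?thesis
    using lim(1) unfolding Let_def C_def S_def by blast
qed

end
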